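(* Let $(X,p_\theta,\theta)$ be a $0$-complete partial extended $b$-metric space. Let $k\in[0,\tfrac12)$ be a constant and let $T:X\to X$ satisfy $$p_\theta(Tx,Ty)\le k\,\big[p_\theta(x,Tx)+p_\theta(y,Ty)\big]\qquad\text{for all }x,y\in X,$$ and $\theta(Tx,x)<\frac1k$ for all $x\in X$. Then $T$ has a unique fixed point $u\in X$. Moreover, $p_\theta(u,u)=0$ and $\lim_{n\to\infty}T^n x_0=u$ for all $x_0\in X$.
   Context: Let $X$ be a non-empty set and $\theta:X\times X\to[1,\infty)$. A function $p_\theta:X\times X\to[0,\infty)$ is a partial extended $b$-metric on $X$ (and $(X,p_\theta,\theta)$ is a partial extended $b$-metric space) if for all $x,y,z\in X$: (1) $p_\theta(x,x)=p_\theta(x,y)=p_\theta(y,y)$ if and only if $x=y$; (2) $p_\theta(x,x)\le p_\theta(x,y)$; (3) $p_\theta(x,y)=p_\theta(y,x)$; (4) $p_\theta(x,z)\le\theta(x,z)\,[p_\theta(x,y)+p_\theta(y,z)]-p_\theta(y,y)$. A sequence $\{x_n\}$ in $X$ converges to $x\in X$ (written $\lim_{n\to\infty}x_n=x$) if $\lim_{n\to\infty}p_\theta(x_n,x)=p_\theta(x,x)$. A sequence $\{x_n\}$ in $X$ is $0$-Cauchy if $\lim_{n,m\to\infty}p_\theta(x_n,x_m)=0$. The space is $0$-complete if for each $0$-Cauchy sequence $\{x_n\}$ in $X$ there exists $x\in X$ such that $\lim_{n,m\to\infty}p_\theta(x_n,x_m)=\lim_{n\to\infty}p_\theta(x_n,x)=p_\theta(x,x)=0$.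 When $k=0$, $\frac1k$ is read as $+\infty$. *)

theory Defs
  imports "HOL-Analysis.Analysis"
begin

text \<open>The carrier \<open>X\<close> is a set rather than a type; the values of \<open>p\<close> and \<open>\<theta>\<close> outside
  \<open>X \<times> X\<close> are irrelevant. Note that \<open>\<theta>\<close> is not assumed to be symmetric.\<close>

locale partial_extended_b_metric_space =
  fixes X :: "'a set" and p :: "'a \<Rightarrow> 'a \<Rightarrow> real" and \<theta> :: "'a \<Rightarrow> 'a \<Rightarrow> real"
  assumes nonempty: "X \<noteq> {}"
    and theta_ge_1: "\<And>x y. x \<in> X \<Longrightarrow> y \<in> X \<Longrightarrow> \<theta> x y \<ge> 1"
    and nonneg: "\<And>x y. x \<in> X \<Longrightarrow> y \<in> X \<Longrightarrow> p x y \<ge> 0"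
    and eq_iff: "\<And>x y. x \<in> X \<Longrightarrow> y \<in> X \<Longrightarrow> (p x x = p x y \<and> p x y = p y y) \<longleftrightarrow> x = y"
    and self_le: "\<And>x y. x \<in> X \<Longrightarrow> y \<in> X \<Longrightarrow> p x x \<le> p x y"
    and sym: "\<And>x y. x \<in> X \<Longrightarrow> y \<in> X \<Longrightarrow> p x y = p y x"
    and triangle: "\<And>x y z. x \<in> X \<Longrightarrow> y \<in> X \<Longrightarrow> z \<in> X \<Longrightarrow>
      p x z \<le> \<theta> x z * (p x y + p y z) - p y y"

definition pconverges :: "('a \<Rightarrow> 'a \<Rightarrow> real) \<Rightarrow> (nat \<Rightarrow> 'a) \<Rightarrow> 'a \<Rightarrow> bool" where
  "pconverges p s x \<longleftrightarrow> (\<lambda>n. p (s n) x) \<longlonglongrightarrow> p x x"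

text \<open>Limits \<open>n, m \<rightarrow> \<infinity>\<close> are joint double limits, taken along the product filter.\<close>

definition zero_Cauchy :: "('a \<Rightarrow> 'a \<Rightarrow> real) \<Rightarrow> (nat \<Rightarrow> 'a) \<Rightarrow> bool" where
  "zero_Cauchy p s \<longleftrightarrow>
     ((\<lambda>(n, m). p (s n) (s m)) \<longlongrightarrow> 0) (sequentially \<times>\<^sub>F sequentially)"

definition zero_complete :: "'a set \<Rightarrow> ('a \<Rightarrow> 'a \<Rightarrow> real) \<Rightarrow> bool" where
  "zero_complete X p \<longleftrightarrow>
     (\<forall>s. range s \<subseteq> X \<and> zero_Cauchy p s \<longrightarrow>
       (\<exists>x\<in>X. ((\<lambda>(n, m). p (s n) (s m)) \<longlongrightarrow> 0) (sequentially \<times>\<^sub>F sequentially) \<and>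
              (\<lambda>n. p (s n) x) \<longlonglongrightarrow> 0 \<and> p x x = 0))"

end

theory Submission imports Defs begin

text \<open>
  This is Kannan's fixed point theorem. Its contraction condition bounds \<open>p (T x) (T y)\<close> by
  the two displacements \<open>p x (T x)\<close> and \<open>p y (T y)\<close> alone, so almost everything is
  controlled without the triangle inequality, whose factor \<open>\<theta>\<close> need not be bounded.
  Along an orbit, the condition applied to neighbouring points makes the displacements shrink
  geometrically with ratio \<open>k / (1 - k) < 1\<close> (\<open>displacement_orbit_tendsto_zero\<close>). Applied to
  two arbitrary points of the orbit it then bounds their distance by two displacements, so the orbit
  is \<open>0\<close>-Cauchy (\<open>orbit_zero_Cauchy\<close>); applied to a point of the orbit and a fixed point it
  shows that the orbit converges to that fixed point (\<open>orbit_tendsto_fixed_point\<close>).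

  The triangle inequality enters once, to see that the limit \<open>u\<close> of an orbit is fixed
  (\<open>orbit_limit_fixed\<close>): passing through a far point of the orbit gives
  \<open>p (T u) u \<le> \<theta> (T u) u * k * p (T u) u\<close> in the limit, and the hypothesis on \<open>\<theta>\<close> says precisely
  that the factor \<open>\<theta> (T u) u * k\<close> is less than \<open>1\<close>.
\<close>

lemma mult_less_1_if_ereal_less_inverse:
  fixes t k :: real
  assumes "0 \<le> k" and "ereal t < 1 / ereal k"
  shows "t * k < 1"
proof (cases "k = 0")
  case False
  then have "ereal t < ereal (1 / k)"
    using assms(2) by (simp add: one_ereal_def)
  then show ?thesis
    using False assms(1) by (simp add: field_simps)
qed simp

context partial_extended_b_metric_space
begin

text \<open>A zero distance forces both self-distances to vanish, as they are bounded by it.\<close>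

lemma eq_if_dist_zero:
  assumes "x \<in> X" "y \<in> X" "p x y = 0"
  shows "x = y"
proof -
  have "p x x = 0" "p y y = 0"
    using assms self_le[of x y] self_le[of y x] sym[of x y] nonneg[of x x] nonneg[of y y] by auto
  then show ?thesis
    using assms eq_iff[of x y] by simp
qed

end

locale kannan_contraction = partial_extended_b_metric_space X p \<theta>
  for X :: "'a set" and p \<theta> :: "'a \<Rightarrow> 'a \<Rightarrow> real" +
  fixes T :: "'a \<Rightarrow> 'a" and k :: real
  assumes k_nonneg: "0 \<le> k"
    and k_less_half: "k < 1 / 2"
    and maps_to: "x \<in> X \<Longrightarrow> T x \<in> X"
    and kannan: "x \<in> X \<Longrightarrow> y \<in> X \<Longrightarrow> p (T x) (T y) \<le> k * (p x (T x) + p y (T y))"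
begin

lemma orbit_in: "x \<in> X \<Longrightarrow> (T ^^ n) x \<in> X"
  by (induction n) (simp_all add: maps_to)

text \<open>The displacement of \<open>T x\<close> occurs on both sides of the contraction condition for
  \<open>x\<close> and \<open>T x\<close>; solving for it produces the ratio \<open>k / (1 - k)\<close>.\<close>

lemma displacement_step:
  assumes "x \<in> X"
  shows "p (T x) (T (T x)) \<le> k / (1 - k) * p x (T x)"
proof -
  have "(1 - k) * p (T x) (T (T x)) \<le> k * p x (T x)"
    using kannan[OF assms maps_to[OF assms]] by (simp add: algebra_simps)
  then show ?thesis
    using k_less_half by (simp add: field_simps)
qed

lemma displacement_orbit_le:
  assumes "x \<in> X"
  shows "p ((T ^^ n) x) (T ((T ^^ n) x)) \<le> (k / (1 - k)) ^ n * p x (T x)"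
proof (induction n)
  case (Suc n)
  have "p ((T ^^ Suc n) x) (T ((T ^^ Suc n) x)) \<le> k / (1 - k) * p ((T ^^ n) x) (T ((T ^^ n) x))"
    using displacement_step[OF orbit_in[OF assms]] by simp
  also have "\<dots> \<le> k / (1 - k) * ((k / (1 - k)) ^ n * p x (T x))"
    using k_nonneg k_less_half by (intro mult_left_mono Suc.IH) simp
  finally show ?case
    by (simp add: mult.assoc)
qed simp

text \<open>Since \<open>k < 1 / 2\<close>, the ratio \<open>k / (1 - k)\<close> of the geometric bound is less than \<open>1\<close>.\<close>

lemma displacement_orbit_tendsto_zero:
  assumes "x \<in> X"
  shows "(\<lambda>n. p ((T ^^ n) x) (T ((T ^^ n) x))) \<longlonglongrightarrow> 0"
proof (rule tendsto_sandwich[OF _ _ tendsto_const])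
  have "(\<lambda>n. (k / (1 - k)) ^ n) \<longlonglongrightarrow> 0"
    using k_nonneg k_less_half by (intro LIMSEQ_power_zero) (simp add: field_simps)
  then show "(\<lambda>n. (k / (1 - k)) ^ n * p x (T x)) \<longlonglongrightarrow> 0"
    by (rule tendsto_mult_left_zero)
  show "\<forall>\<^sub>F n in sequentially. 0 \<le> p ((T ^^ n) x) (T ((T ^^ n) x))"
    by (intro always_eventually allI nonneg maps_to orbit_in assms)
  show "\<forall>\<^sub>F n in sequentially. p ((T ^^ n) x) (T ((T ^^ n) x)) \<le> (k / (1 - k)) ^ n * p x (T x)"
    by (intro always_eventually allI displacement_orbit_le assms)
qed

text \<open>The contraction condition bounds a distance between images, so the sequence starts at
  \<open>T x\<close>; this way each of its terms is an image.\<close>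

lemma orbit_zero_Cauchy:
  assumes "x \<in> X"
  shows "zero_Cauchy p (\<lambda>n. (T ^^ Suc n) x)"
proof -
  define d where "d n = p ((T ^^ n) x) (T ((T ^^ n) x))" for n
  have d: "d \<longlonglongrightarrow> 0"
    unfolding d_def by (rule displacement_orbit_tendsto_zero[OF assms])
  have "((\<lambda>z. k * (d (fst z) + d (snd z))) \<longlongrightarrow> k * (0 + 0)) (sequentially \<times>\<^sub>F sequentially)"
    by (intro tendsto_intros filterlim_compose[OF d] filterlim_fst filterlim_snd)
  then have lim: "((\<lambda>z. k * (d (fst z) + d (snd z))) \<longlongrightarrow> 0) (sequentially \<times>\<^sub>F sequentially)"
    by simp
  have "((\<lambda>z. p ((T ^^ Suc (fst z)) x) ((T ^^ Suc (snd z)) x)) \<longlongrightarrow> 0)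
      (sequentially \<times>\<^sub>F sequentially)"
  proof (rule tendsto_sandwich[OF _ _ tendsto_const lim])
    show "\<forall>\<^sub>F z in sequentially \<times>\<^sub>F sequentially. 0 \<le> p ((T ^^ Suc (fst z)) x) ((T ^^ Suc (snd z)) x)"
      by (intro always_eventually allI nonneg orbit_in assms)
    show "\<forall>\<^sub>F z in sequentially \<times>\<^sub>F sequentially.
        p ((T ^^ Suc (fst z)) x) ((T ^^ Suc (snd z)) x) \<le> k * (d (fst z) + d (snd z))"
      using kannan[OF orbit_in[OF assms] orbit_in[OF assms]]
      by (intro always_eventually allI) (simp add: d_def)
  qed
  then show ?thesis
    by (simp add: zero_Cauchy_def case_prod_beta')
qed

text \<open>For a fixed point the condition reads \<open>p u u \<le> 2 * k * p u u\<close>, where \<open>2 * k < 1\<close>.\<close>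

lemma fixed_point_self_dist:
  assumes "u \<in> X" "T u = u"
  shows "p u u = 0"
proof -
  have "(1 - 2 * k) * p u u \<le> 0"
    using kannan[OF assms(1,1)] assms(2) by (simp add: algebra_simps)
  then have "p u u \<le> 0"
    using k_less_half by (simp add: mult_le_0_iff)
  then show ?thesis
    using nonneg[OF assms(1,1)] by simp
qed

lemma fixed_point_unique:
  assumes "u \<in> X" "T u = u" "v \<in> X" "T v = v"
  shows "u = v"
proof (rule eq_if_dist_zero[OF assms(1,3)])
  have "p u v \<le> 0"
    using kannan[OF assms(1,3)] assms(2,4)
      fixed_point_self_dist[OF assms(1,2)] fixed_point_self_dist[OF assms(3,4)] by simp
  then show "p u v = 0"
    using nonneg[OF assms(1,3)] by simp
qed

text \<open>Since a fixed point has displacement \<open>p u u = 0\<close>, the condition gives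
  \<open>p (T y) u \<le> k * p y (T y)\<close>, and the displacements along the orbit tend to \<open>0\<close>.\<close>

lemma orbit_tendsto_fixed_point:
  assumes "u \<in> X" "T u = u" "x \<in> X"
  shows "pconverges p (\<lambda>n. (T ^^ n) x) u"
proof -
  have lim: "(\<lambda>n. k * p ((T ^^ n) x) (T ((T ^^ n) x))) \<longlonglongrightarrow> 0"
    by (intro tendsto_mult_right_zero displacement_orbit_tendsto_zero assms(3))
  have "(\<lambda>n. p ((T ^^ Suc n) x) u) \<longlonglongrightarrow> 0"
  proof (rule tendsto_sandwich[OF _ _ tendsto_const lim])
    show "\<forall>\<^sub>F n in sequentially. 0 \<le> p ((T ^^ Suc n) x) u"
      by (intro always_eventually allI nonneg orbit_in assms)
    show "\<forall>\<^sub>F n in sequentially. p ((T ^^ Suc n) x) u \<le> k * p ((T ^^ n) x) (T ((T ^^ n) x))"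
      using kannan[OF orbit_in[OF assms(3)] assms(1)] assms(2)
        fixed_point_self_dist[OF assms(1,2)]
      by (intro always_eventually allI) simp
  qed
  then show ?thesis
    unfolding pconverges_def fixed_point_self_dist[OF assms(1,2)] by (rule LIMSEQ_imp_Suc)
qed

text \<open>The triangle inequality is used for \<open>p (T u) u\<close> in this order of the arguments: \<open>\<theta>\<close>
  may be asymmetric, and only \<open>\<theta> (T u) u\<close> is bounded.\<close>

lemma orbit_limit_fixed:
  assumes "x \<in> X" "u \<in> X" and lim: "(\<lambda>n. p ((T ^^ Suc n) x) u) \<longlonglongrightarrow> 0"
    and theta: "\<theta> (T u) u * k < 1"
  shows "T u = u"
proof (rule eq_if_dist_zero[OF maps_to[OF assms(2)] assms(2)])
  define d where "d n = p ((T ^^ n) x) (T ((T ^^ n) x))" for n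
  have Tu: "T u \<in> X"
    by (rule maps_to[OF assms(2)])
  have bound: "p (T u) u \<le> \<theta> (T u) u * (k * (d n + p (T u) u) + p ((T ^^ Suc n) x) u)" for n
  proof -
    let ?y = "(T ^^ Suc n) x"
    have y: "?y \<in> X"
      by (rule orbit_in[OF assms(1)])
    have "p (T u) ?y \<le> k * (d n + p (T u) u)"
      using kannan[OF assms(2) orbit_in[OF assms(1), of n]] sym[OF Tu assms(2)]
      by (simp add: d_def add.commute)
    then have "\<theta> (T u) u * (p (T u) ?y + p ?y u)
        \<le> \<theta> (T u) u * (k * (d n + p (T u) u) + p ?y u)"
      using theta_ge_1[OF Tu assms(2)] by (intro mult_left_mono add_right_mono) auto
    then show ?thesis
      using triangle[OF Tu y assms(2)] nonneg[OF y y] by linarith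
  qed
  have "d \<longlonglongrightarrow> 0"
    unfolding d_def by (rule displacement_orbit_tendsto_zero[OF assms(1)])
  then have "(\<lambda>n. \<theta> (T u) u * (k * (d n + p (T u) u) + p ((T ^^ Suc n) x) u))
      \<longlonglongrightarrow> \<theta> (T u) u * (k * (0 + p (T u) u) + 0)"
    by (intro tendsto_intros lim)
  then have "p (T u) u \<le> \<theta> (T u) u * (k * (0 + p (T u) u) + 0)"
    by (rule LIMSEQ_le_const) (use bound in blast)
  then have "(1 - \<theta> (T u) u * k) * p (T u) u \<le> 0"
    by (simp add: algebra_simps)
  then have "p (T u) u \<le> 0"
    using theta by (simp add: mult_le_0_iff)
  then show "p (T u) u = 0"
    using nonneg[OF Tu assms(2)] by simp
qed

lemma fixed_point_exists:
  assumes "zero_complete X p" and theta: "\<And>x. x \<in> X \<Longrightarrow> \<theta> (T x) x * k < 1"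
  shows "\<exists>u\<in>X. T u = u"
proof -
  obtain x where x: "x \<in> X"
    using nonempty by blast
  have "range (\<lambda>n. (T ^^ Suc n) x) \<subseteq> X"
    using orbit_in[OF x] by blast
  then obtain u where "u \<in> X" "(\<lambda>n. p ((T ^^ Suc n) x) u) \<longlonglongrightarrow> 0"
    using assms(1) orbit_zero_Cauchy[OF x] unfolding zero_complete_def by blast
  then show ?thesis
    using orbit_limit_fixed[OF x] theta by blast
qed

end

theorem theorem3p10:
  fixes X :: "'a set" and p \<theta> :: "'a \<Rightarrow> 'a \<Rightarrow> real" and k :: real and T :: "'a \<Rightarrow> 'a"
  assumes "partial_extended_b_metric_space X p \<theta>"
    and "zero_complete X p"
    and "0 \<le> k" and "k < 1 / 2"
    and "T \<in> X \<rightarrow> X"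
    and "\<And>x y. x \<in> X \<Longrightarrow> y \<in> X \<Longrightarrow> p (T x) (T y) \<le> k * (p x (T x) + p y (T y))"
    \<comment> \<open>in \<open>ereal\<close>, \<open>1 / 0 = \<infinity>\<close>\<close>
    and "\<And>x. x \<in> X \<Longrightarrow> ereal (\<theta> (T x) x) < 1 / ereal k"
  shows "(\<exists>!u. u \<in> X \<and> T u = u) \<and>
    (\<forall>u\<in>X. T u = u \<longrightarrow> p u u = 0 \<and> (\<forall>x0\<in>X. pconverges p (\<lambda>n. (T ^^ n) x0) u))"
proof -
  interpret partial_extended_b_metric_space X p \<theta>
    by fact
  interpret kannan_contraction X p \<theta> T k
    using assms(3-6) by unfold_locales (auto simp: Pi_iff)
  have "\<exists>u\<in>X. T u = u"
    using assms(2) mult_less_1_if_ereal_less_inverse[OF assms(3,7)] by (rule fixed_point_exists)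
  then show ?thesis
    using fixed_point_unique fixed_point_self_dist orbit_tendsto_fixed_point by blast
qed

end
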